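(* Let $n\ge 1$, let $\mathbf{A}_l=\sigma_0\otimes\sigma_1\otimes\dots\otimes\sigma_{n-1}$ with each $\sigma_i\in\mathbb{S}$, where $\mathbb{S}$ is the Sigma basis, and let $s$ be the number of indices $i\in\{0,\dots,n-1\}$ with $\sigma_i\in\{\sigma_+,\sigma_-\}$. Then the operator on $n+1$ qubits $$\tilde{\mathbf{U}}_l=\begin{bmatrix}\mathbf{A}_l & \mathbf{I}-\mathbf{A}_l\mathbf{A}_l^T\\ \mathbf{I}-\mathbf{A}_l^T\mathbf{A}_l & \mathbf{A}_l^T\end{bmatrix}$$ can be implemented using one single-qubit gate and $2s+1$ $C^mX$ gates, where $m\le n$.
   Context: The Sigma basis is $\mathbb{S}=\{\mathbf{I}_2,\ \sigma_+,\ \sigma_-,\ \sigma_+\sigma_-,\ \sigma_-\sigma_+\}$ with $\sigma_+=|0\rangle\langle 1|=\begin{bmatrix}0&1\\0&0\end{bmatrix}$, $\sigma_-=|1\rangle\langle 0|=\begin{bmatrix}0&0\\1&0\end{bmatrix}$, $\sigma_+\sigma_-=|0\rangle\langle 0|=\begin{bmatrix}1&0\\0&0\end{bmatrix}$, $\sigma_-\sigma_+=|1\rangle\langle 1|=\begin{bmatrix}0&0\\0&1\end{bmatrix}$. $\mathbf{I}$ in the block matrix is the $2^n\times 2^n$ identity. The operator $\tilde{\mathbf{U}}_l$ is (up to the sign of its lower-right block) the unitary dilation of the contraction $\mathbf{A}_l$. The $n+1$ qubits are an ancilla qubit (the most significant one, indexing the $2\times2$ block structure) and $n$ qubits on which the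 tensor factors $\sigma_0,\dots,\sigma_{n-1}$ act. A $C^mX$ gate has $m$ control qubits and one target qubit; each control is either closed (active when the control qubit is $1$) or open (active when it is $0$), and $X=\begin{bmatrix}0&1\\1&0\end{bmatrix}$ is applied to the target exactly when all controls are active; the gate acts as the identity on the remaining qubits. $C^0X$ is the gate $X$. "Implemented using" certain gates means that the operator equals a product of those gates, each acting on the $n+1$ qubits. *)

theory Defs
  imports "Jordan_Normal_Form.Schur_Decomposition"
begin

definition sigma_plus :: "complex mat" where
  "sigma_plus = mat_of_rows_list 2 [[0, 1], [0, 0]]"

definition sigma_minus :: "complex mat" where
  "sigma_minus = mat_of_rows_list 2 [[0, 0], [1, 0]]"

definition sigma_basis :: "complex mat set" where
  "sigma_basis =
     {1\<^sub>m 2, sigma_plus, sigma_minus, sigma_plus * sigma_minus, sigma_minus * sigma_plus}"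

definition tensor_mat :: "complex mat \<Rightarrow> complex mat \<Rightarrow> complex mat" where
  "tensor_mat A B = mat (dim_row A * dim_row B) (dim_col A * dim_col B)
     (\<lambda>(i, j). A $$ (i div dim_row B, j div dim_col B) * B $$ (i mod dim_row B, j mod dim_col B))"

definition tensor_list :: "complex mat list \<Rightarrow> complex mat" where
  "tensor_list Ms = foldr tensor_mat Ms (1\<^sub>m 1)"

definition dilation_op :: "nat \<Rightarrow> complex mat \<Rightarrow> complex mat" where
  "dilation_op n A =
     four_block_mat A (1\<^sub>m (2 ^ n) - A * transpose_mat A)
                    (1\<^sub>m (2 ^ n) - transpose_mat A * A) (transpose_mat A)"

definition unitary_mat2 :: "complex mat \<Rightarrow> bool" where
  "unitary_mat2 V \<longleftrightarrow>
     V \<in> carrier_mat 2 2 \<and> V * mat_adjoint V = 1\<^sub>m 2 \<and> mat_adjoint V * V = 1\<^sub>m 2"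

definition X_gate :: "complex mat" where
  "X_gate = mat_of_rows_list 2 [[0, 1], [1, 0]]"

text \<open>
  A register of \<open>N\<close> qubits is numbered \<open>0, \<dots>, N - 1\<close> from the most significant to the least
  significant one. In the block matrix of \<^const>\<open>dilation_op\<close> (with \<open>N = n + 1\<close>), qubit \<open>0\<close> is
  therefore the ancilla and qubit \<open>i + 1\<close> carries the \<open>i\<close>-th tensor factor.
\<close>

definition qubit_val :: "nat \<Rightarrow> nat \<Rightarrow> nat \<Rightarrow> nat" where
  "qubit_val N q x = (x div 2 ^ (N - 1 - q)) mod 2"

definition on_qubit :: "nat \<Rightarrow> nat \<Rightarrow> complex mat \<Rightarrow> complex mat" where
  "on_qubit N q V = tensor_mat (tensor_mat (1\<^sub>m (2 ^ q)) V) (1\<^sub>m (2 ^ (N - 1 - q)))"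

text \<open>
  \<open>CX C P t\<close> is a controlled \<open>X\<close> gate with closed controls \<open>C\<close>, open controls \<open>P\<close> and target \<open>t\<close>.
\<close>

datatype gate = Single nat "complex mat" | CX "nat set" "nat set" nat

fun valid_gate :: "nat \<Rightarrow> gate \<Rightarrow> bool" where
  "valid_gate N (Single q V) \<longleftrightarrow> q < N \<and> unitary_mat2 V"
| "valid_gate N (CX C P t) \<longleftrightarrow>
     t < N \<and> C \<subseteq> {..<N} \<and> P \<subseteq> {..<N} \<and> C \<inter> P = {} \<and> t \<notin> C \<and> t \<notin> P"

fun is_single :: "gate \<Rightarrow> bool" where
  "is_single (Single q V) \<longleftrightarrow> True"
| "is_single (CX C P t) \<longleftrightarrow> False"

fun is_CmX :: "nat \<Rightarrow> gate \<Rightarrow> bool" where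
  "is_CmX m (Single q V) \<longleftrightarrow> False"
| "is_CmX m (CX C P t) \<longleftrightarrow> card (C \<union> P) = m"

text \<open>
  Column \<open>j\<close> of the matrix of \<open>CX C P t\<close> is the image of the basis state \<open>j\<close>.
\<close>

fun gate_mat :: "nat \<Rightarrow> gate \<Rightarrow> complex mat" where
  "gate_mat N (Single q V) = on_qubit N q V"
| "gate_mat N (CX C P t) = mat (2 ^ N) (2 ^ N)
     (\<lambda>(i, j). if (\<forall>c\<in>C. qubit_val N c j = 1) \<and> (\<forall>c\<in>P. qubit_val N c j = 0)
               then on_qubit N t X_gate $$ (i, j) else 1\<^sub>m (2 ^ N) $$ (i, j))"

definition circuit_mat :: "nat \<Rightarrow> gate list \<Rightarrow> complex mat" where
  "circuit_mat N gs = foldr (\<lambda>g M. gate_mat N g * M) gs (1\<^sub>m (2 ^ N))"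

end

theory Submission
  imports Defs
begin

text \<open>
  Each factor in the Sigma basis is a partial permutation of the two basis states: it may require the
  input bit to have a fixed value, and it flips the bit exactly for \<open>\<sigma>\<^sub>+\<close> and \<open>\<sigma>\<^sub>-\<close>. So
  \<open>A\<close> maps \<open>j\<close> to \<open>f j = j XOR mask\<close> if \<open>j\<close> satisfies these requirements (\<open>D j\<close>) and annihilates it
  otherwise, and the dilation is a permutation matrix. Followed by \<open>X\<close> on the ancilla, it exchanges
  \<open>(0, j)\<close> with \<open>(1, f j)\<close> for all \<open>j\<close> in \<open>D\<close> and fixes everything else. Conjugation
  by the \<open>s\<close> CNOT gates from the ancilla to the flipped qubits turns this exchange into
  \<open>(0, j) \<leftrightarrow> (1, j)\<close>, which is a single multi-controlled \<open>X\<close> on the ancilla.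
\<close>

unbundle bit_operations_syntax

section \<open>Permutation matrices\<close>

definition perm_mat :: "nat \<Rightarrow> (nat \<Rightarrow> nat) \<Rightarrow> complex mat" where
  "perm_mat N f = mat (2 ^ N) (2 ^ N) (\<lambda>(i, j). of_bool (i = f j))"

lemma perm_mat_carrier [simp]: "perm_mat N f \<in> carrier_mat (2 ^ N) (2 ^ N)"
  by (simp add: perm_mat_def)

lemma perm_mat_cong: "(\<And>j. j < 2 ^ N \<Longrightarrow> f j = g j) \<Longrightarrow> perm_mat N f = perm_mat N g"
  by (intro eq_matI) (auto simp: perm_mat_def)

text \<open>In the sum for an entry only the term \<open>k = g j\<close> survives, and the bound on
  \<open>g\<close> guarantees that this index is among those summed over.\<close>

lemma perm_mat_mult:
  assumes "\<And>j. j < 2 ^ N \<Longrightarrow> g j < 2 ^ N"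
  shows "perm_mat N f * perm_mat N g = perm_mat N (\<lambda>j. f (g j))"
proof (intro eq_matI)
  fix i j assume "i < dim_row (perm_mat N (\<lambda>j. f (g j)))" "j < dim_col (perm_mat N (\<lambda>j. f (g j)))"
  then have ij: "i < 2 ^ N" "j < 2 ^ N" by (auto simp: perm_mat_def)
  have "(\<Sum>k = 0..<2 ^ N. of_bool (i = f k) * of_bool (k = g j)) =
      (\<Sum>k = 0..<2 ^ N. if k = g j then of_bool (i = f k) else 0 :: complex)"
    by (intro sum.cong) auto
  also have "\<dots> = of_bool (i = f (g j))"
    using assms[OF ij(2)] by (simp add: sum.delta)
  finally show "(perm_mat N f * perm_mat N g) $$ (i, j) = perm_mat N (\<lambda>j. f (g j)) $$ (i, j)"
    using ij by (simp add: perm_mat_def scalar_prod_def)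
qed (auto simp: perm_mat_def)

section \<open>Bits and XOR of natural numbers\<close>

lemma xor_nat_less_power2:
  fixes a b :: nat
  assumes "a < 2 ^ N" "b < 2 ^ N"
  shows "a XOR b < 2 ^ N"
proof -
  have "take_bit N (a XOR b) = a XOR b"
    using assms by (simp add: take_bit_nat_eq_self)
  then show ?thesis by (simp only: take_bit_nat_eq_self_iff)
qed

lemma bit_index_less: "x < 2 ^ N \<Longrightarrow> bit x k \<Longrightarrow> k < N" for x :: nat
  by (metis bit_take_bit_iff take_bit_nat_eq_self)

lemma eq_iff_bits_below:
  fixes x y :: nat
  assumes "x < 2 ^ n" "y < 2 ^ n"
  shows "x = y \<longleftrightarrow> (\<forall>k<n. bit x k = bit y k)"
  using assms by (auto simp: bit_eq_iff dest: bit_index_less)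

lemma qubit_val_bit: "qubit_val N q x = of_bool (bit x (N - 1 - q))"
  by (simp add: qubit_val_def bit_iff_odd mod_2_eq_odd)

text \<open>The index arithmetic of identity \<otimes> X \<otimes> identity compares high bits, bit
  \<open>r\<close> and low bits separately, through \<open>div\<close> and \<open>mod\<close>.
  Splitting the bitwise form of XOR at position \<open>r\<close> yields the same three
  comparisons.\<close>

lemma xor_power2_iff:
  fixes i j :: nat
  shows "i = j XOR 2 ^ r \<longleftrightarrow>
    i div 2 ^ r div 2 = j div 2 ^ r div 2 \<and> bit i r \<noteq> bit j r \<and> i mod 2 ^ r = j mod 2 ^ r"
proof -
  have split: "(\<forall>k. P k) \<longleftrightarrow> (\<forall>k. P (Suc r + k)) \<and> P r \<and> (\<forall>k<r. P k)" for P
  proof (intro iffI allI)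
    fix k assume P: "(\<forall>k. P (Suc r + k)) \<and> P r \<and> (\<forall>k<r. P k)"
    consider "k < r" | "k = r" | "k = Suc r + (k - Suc r)" by linarith
    then show "P k" using P by cases metis+
  qed auto
  have "m div 2 ^ r div 2 = drop_bit (Suc r) m" for m :: nat
    by (simp add: drop_bit_eq_div div_mult2_eq[symmetric] mult.commute)
  then have "i div 2 ^ r div 2 = j div 2 ^ r div 2 \<longleftrightarrow> (\<forall>k. bit i (Suc r + k) = bit j (Suc r + k))"
    by (simp add: bit_eq_iff bit_drop_bit_eq)
  moreover have "i mod 2 ^ r = j mod 2 ^ r \<longleftrightarrow> (\<forall>k<r. bit i k = bit j k)"
    unfolding take_bit_eq_mod[symmetric] bit_eq_iff bit_take_bit_iff by auto
  moreover have "i = j XOR 2 ^ r \<longleftrightarrow> (\<forall>k. bit i k = (bit j k \<noteq> (k = r)))"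
    unfolding bit_eq_iff[of i] by (simp add: bit_xor_iff bit_exp_iff eq_commute[of r])
  ultimately show ?thesis
    unfolding split[of "\<lambda>k. bit i k = (bit j k \<noteq> (k = r))"] by auto
qed

text \<open>Bit \<open>n\<close> of \<open>x\<close> is clear, so the addition produces no carry.
  This turns the offset of the second block into a flip of the ancilla bit.\<close>

lemma add_power2_eq_xor: "x < 2 ^ n \<Longrightarrow> 2 ^ n + x = x XOR 2 ^ n" for x :: nat
  by (subst xor_power2_iff) (simp add: bit_iff_odd)

text \<open>The map from \<open>k\<close> to \<open>n - 1 - k\<close> is an involution below
  \<open>n\<close>. It reconciles tensor positions, counted from the most significant end, with bit
  positions.\<close>

lemma all_less_reverse_iff: "(\<forall>k<n. Q (n - 1 - k)) \<longleftrightarrow> (\<forall>k<n. Q k)" for n :: nat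
proof -
  have "n - 1 - k < n" "n - 1 - (n - 1 - k) = k" if "k < n" for k
    using that by auto
  then show ?thesis by metis
qed

lemma prod_of_bool_lessThan: "(\<Prod>k<n. of_bool (Q k)) = (of_bool (\<forall>k<n. Q k) :: 'a :: comm_semiring_1)" for n :: nat
  by (induction n) (auto simp: less_Suc_eq)

section \<open>Gates as permutation matrices\<close>

lemma X_gate_entry: "a < 2 \<Longrightarrow> b < 2 \<Longrightarrow> X_gate $$ (a, b) = of_bool (a \<noteq> b)"
  by (auto simp: X_gate_def mat_of_rows_list_def numeral_2_eq_2 less_Suc_eq)

lemma X_gate_dim [simp]: "dim_row X_gate = 2" "dim_col X_gate = 2"
  by (auto simp: X_gate_def mat_of_rows_list_def)

lemma unitary_mat2_X_gate: "unitary_mat2 X_gate"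
proof -
  have "mat_adjoint X_gate = X_gate"
    by (intro eq_matI) (auto simp: mat_adjoint_def mat_of_rows_def X_gate_entry numeral_2_eq_2 less_Suc_eq)
  moreover have "X_gate * X_gate = 1\<^sub>m 2"
    by (intro eq_matI) (auto simp: X_gate_def mat_of_rows_list_def scalar_prod_def numeral_2_eq_2 less_Suc_eq)
  ultimately show ?thesis by (auto simp: unitary_mat2_def)
qed

lemma qubit_split_dims: "q < N \<Longrightarrow> (2::nat) ^ q * 2 * 2 ^ (N - 1 - q) = 2 ^ N"
  by (auto simp: less_iff_Suc_add power_add)

lemma on_qubit_X:
  assumes "t < N"
  shows "on_qubit N t X_gate = perm_mat N (\<lambda>j. j XOR 2 ^ (N - 1 - t))"
proof -
  define r where "r = N - 1 - t"
  have dims: "(2::nat) ^ t * 2 * 2 ^ r = 2 ^ N" using qubit_split_dims[OF assms] by (simp add: r_def)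
  have entry: "on_qubit N t X_gate $$ (i, j) = of_bool (i = j XOR 2 ^ r)"
    if "i < 2 ^ N" "j < 2 ^ N" for i j
  proof -
    \<comment> \<open>These bounds keep the indices passed to the left factors of the two nested
      tensor products within range, where the entries are specified.\<close>
    have lt: "k div 2 ^ r < 2 ^ t * 2" "k div 2 ^ r div 2 < 2 ^ t" if "k < 2 ^ N" for k :: nat
      using that by (auto simp: less_mult_imp_div_less dims)
    show ?thesis
      using that lt[OF that(1)] lt[OF that(2)] unfolding on_qubit_def r_def[symmetric]
      by (auto simp: tensor_mat_def dims X_gate_entry xor_power2_iff bit_iff_odd mod_2_eq_odd)
  qed
  show ?thesis
    unfolding r_def[symmetric]
  proof (intro eq_matI)
    show "dim_row (on_qubit N t X_gate) = dim_row (perm_mat N (\<lambda>j. j XOR 2 ^ r))"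
      "dim_col (on_qubit N t X_gate) = dim_col (perm_mat N (\<lambda>j. j XOR 2 ^ r))"
      unfolding on_qubit_def r_def[symmetric] by (simp_all add: perm_mat_def tensor_mat_def dims)
  qed (simp add: entry perm_mat_def)
qed

lemma gate_mat_CX:
  assumes "t < N"
  shows "gate_mat N (CX C P t) = perm_mat N (\<lambda>j.
     if (\<forall>c\<in>C. bit j (N - 1 - c)) \<and> (\<forall>c\<in>P. \<not> bit j (N - 1 - c))
     then j XOR 2 ^ (N - 1 - t) else j)"
  by (intro eq_matI) (auto simp: perm_mat_def on_qubit_X[OF assms] qubit_val_bit)

section \<open>Matrices of circuits\<close>

lemma gate_mat_carrier: "valid_gate N g \<Longrightarrow> gate_mat N g \<in> carrier_mat (2 ^ N) (2 ^ N)"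
proof (cases g)
  case (Single q V)
  moreover assume "valid_gate N g"
  ultimately have "q < N" "dim_row V = 2" "dim_col V = 2" by (auto simp: unitary_mat2_def)
  then show ?thesis
    using qubit_split_dims[of q N] unfolding Single gate_mat.simps on_qubit_def
    by (intro carrier_matI) (simp_all only: tensor_mat_def dim_row_mat dim_col_mat index_one_mat)
qed simp

lemma circuit_mat_carrier:
  "(\<And>g. g \<in> set gs \<Longrightarrow> valid_gate N g) \<Longrightarrow> circuit_mat N gs \<in> carrier_mat (2 ^ N) (2 ^ N)"
  by (induction gs) (auto simp: circuit_mat_def intro!: mult_carrier_mat gate_mat_carrier)

lemma circuit_mat_append:
  assumes "\<And>g. g \<in> set gs \<union> set hs \<Longrightarrow> valid_gate N g"
  shows "circuit_mat N (gs @ hs) = circuit_mat N gs * circuit_mat N hs"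
  using assms
proof (induction gs)
  case Nil
  then show ?case using circuit_mat_carrier[of hs N] by (simp add: circuit_mat_def)
next
  case (Cons g gs)
  have "circuit_mat N (g # gs @ hs) = gate_mat N g * (circuit_mat N gs * circuit_mat N hs)"
    using Cons by (simp add: circuit_mat_def)
  also have "\<dots> = (gate_mat N g * circuit_mat N gs) * circuit_mat N hs"
    using Cons.prems
    by (intro assoc_mult_mat[symmetric, of _ "2^N" "2^N" _ "2^N" _ "2^N"] gate_mat_carrier circuit_mat_carrier) auto
  finally show ?case by (simp add: circuit_mat_def)
qed

lemma circuit_mat_Nil: "circuit_mat N [] = perm_mat N (\<lambda>j. j)"
  by (intro eq_matI) (auto simp: circuit_mat_def perm_mat_def)

lemma circuit_mat_Cons: "circuit_mat N (g # gs) = gate_mat N g * circuit_mat N gs"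
  by (simp add: circuit_mat_def)

section \<open>The layer of CNOT gates controlled by the ancilla\<close>

definition flip_mask :: "nat \<Rightarrow> nat list \<Rightarrow> nat" where
  "flip_mask n ks = foldr (\<lambda>k m. m XOR 2 ^ (n - 1 - k)) ks 0"

lemma flip_mask_simps [simp]:
  "flip_mask n [] = 0" "flip_mask n (k # ks) = flip_mask n ks XOR 2 ^ (n - 1 - k)"
  by (simp_all add: flip_mask_def)

lemma flip_mask_less: "set ks \<subseteq> {..<n} \<Longrightarrow> flip_mask n ks < 2 ^ n"
  by (induction ks) (auto intro!: xor_nat_less_power2)

text \<open>Each \<open>k\<close> contributes its own bit \<open>n - 1 - k\<close>. Distinctness
  matters because a repeated index would cancel under XOR.\<close>

lemma bit_flip_mask:
  assumes "distinct ks" "set ks \<subseteq> {..<n}" "k < n"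
  shows "bit (flip_mask n ks) (n - 1 - k) \<longleftrightarrow> k \<in> set ks"
  using assms(1,2)
proof (induction ks)
  case (Cons l ks)
  have "n - 1 - l = n - 1 - k \<longleftrightarrow> l = k" using Cons.prems assms(3) by auto
  with Cons show ?case by (auto simp: bit_xor_iff bit_exp_iff)
qed simp

text \<open>All these gates share the ancilla, bit \<open>n\<close>, as control and none of them
  changes it. Hence every gate sees the same control value, and the flips accumulate into a single
  XOR with the mask.\<close>

lemma circuit_mat_ancilla_cnots:
  assumes "set ks \<subseteq> {..<n}"
  shows "circuit_mat (n + 1) (map (\<lambda>k. CX {0} {} (k + 1)) ks) =
    perm_mat (n + 1) (\<lambda>j. if bit j n then j XOR flip_mask n ks else j)"
  using assms
proof (induction ks)
  case Nil
  then show ?case by (simp add: circuit_mat_Nil cong: if_cong)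
next
  case (Cons k ks)
  have n: "\<not> bit (flip_mask n ks) n" using bit_index_less[OF flip_mask_less[of ks n], of n] Cons.prems by auto
  have mask: "flip_mask n ks < 2 ^ (n + 1)" using flip_mask_less[of ks n] Cons.prems by simp
  moreover have "gate_mat (n + 1) (CX {0} {} (k + 1)) =
     perm_mat (n + 1) (\<lambda>j. if bit j n then j XOR 2 ^ (n - 1 - k) else j)"
    using Cons.prems by (subst gate_mat_CX) (auto intro!: perm_mat_cong)
  ultimately have "circuit_mat (n + 1) (map (\<lambda>k. CX {0} {} (k + 1)) (k # ks)) =
     perm_mat (n + 1) (\<lambda>j. if bit j n then j XOR 2 ^ (n - 1 - k) else j) *
     perm_mat (n + 1) (\<lambda>j. if bit j n then j XOR flip_mask n ks else j)"
    using Cons by (simp add: circuit_mat_Cons del: gate_mat.simps)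
  also have "\<dots> = perm_mat (n + 1) (\<lambda>j. if bit j n then j XOR flip_mask n (k # ks) else j)"
    using n xor_nat_less_power2[OF _ mask] by (subst perm_mat_mult)
      (auto simp: bit_xor_iff xor.assoc intro!: perm_mat_cong)
  finally show ?case .
qed

section \<open>Tensor products of Sigma factors and their dilation\<close>

lemma tensor_list_entry:
  assumes "\<And>M. M \<in> set Ms \<Longrightarrow> M \<in> carrier_mat 2 2"
  shows "tensor_list Ms \<in> carrier_mat (2 ^ length Ms) (2 ^ length Ms) \<and>
    (\<forall>i<2 ^ length Ms. \<forall>j<2 ^ length Ms. tensor_list Ms $$ (i, j) =
      (\<Prod>k<length Ms. (Ms ! k) $$ (of_bool (bit i (length Ms - 1 - k)), of_bool (bit j (length Ms - 1 - k)))))"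
  using assms
proof (induction Ms)
  case Nil
  then show ?case by (simp add: tensor_list_def)
next
  case (Cons M Ms)
  let ?l = "length Ms"
  have dims: "dim_row M = 2" "dim_col M = 2" using Cons.prems by auto
  from Cons have tdims: "tensor_list Ms \<in> carrier_mat (2 ^ ?l) (2 ^ ?l)" by simp
  have rec: "tensor_list (M # Ms) = tensor_mat M (tensor_list Ms)"
    by (simp add: tensor_list_def)
  have car: "tensor_list (M # Ms) \<in> carrier_mat (2 ^ length (M # Ms)) (2 ^ length (M # Ms))"
    using tdims dims by (simp add: rec tensor_mat_def)
  moreover have "tensor_list (M # Ms) $$ (i, j) = (\<Prod>k<length (M # Ms). ((M # Ms) ! k) $$
        (of_bool (bit i (length (M # Ms) - 1 - k)), of_bool (bit j (length (M # Ms) - 1 - k))))"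
    if ij: "i < 2 ^ length (M # Ms)" "j < 2 ^ length (M # Ms)" for i j
  proof -
    \<comment> \<open>The head of the list owns the top bit, which is the quotient by
      \<open>2 ^ ?l\<close>; the remainder keeps all bits that belong to the tail.\<close>
    have hd: "k div 2 ^ ?l = of_bool (bit k ?l)" if "k < 2 ^ length (M # Ms)" for k :: nat
    proof -
      have "k div 2 ^ ?l < 2" using that by (simp add: less_mult_imp_div_less)
      then show ?thesis by (auto simp: bit_iff_odd less_2_cases_iff)
    qed
    have tl: "bit (k mod 2 ^ ?l) (?l - Suc m) = bit k (?l - Suc m)" if "m < ?l" for k m :: nat
      using that unfolding take_bit_eq_mod[symmetric] bit_take_bit_iff by auto
    have "tensor_list (M # Ms) $$ (i, j) =
       M $$ (i div 2 ^ ?l, j div 2 ^ ?l) * tensor_list Ms $$ (i mod 2 ^ ?l, j mod 2 ^ ?l)"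
      using ij tdims dims by (simp add: rec tensor_mat_def)
    also have "\<dots> = M $$ (of_bool (bit i ?l), of_bool (bit j ?l)) *
       (\<Prod>k<?l. (Ms ! k) $$ (of_bool (bit i (?l - 1 - k)), of_bool (bit j (?l - 1 - k))))"
      using Cons hd[OF ij(1)] hd[OF ij(2)] by (simp add: tl)
    finally show ?thesis by (simp add: prod.lessThan_Suc_shift del: prod.lessThan_Suc)
  qed
  ultimately show ?case by blast
qed

lemma sigma_entry:
  "(1\<^sub>m 2 :: complex mat) $$ (of_bool a, of_bool b) = of_bool (a = b)"
  "sigma_plus $$ (of_bool a, of_bool b) = of_bool (\<not> a \<and> b)"
  "sigma_minus $$ (of_bool a, of_bool b) = of_bool (a \<and> \<not> b)"
  "(sigma_plus * sigma_minus) $$ (of_bool a, of_bool b) = of_bool (\<not> a \<and> \<not> b)"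
  "(sigma_minus * sigma_plus) $$ (of_bool a, of_bool b) = of_bool (a \<and> b)"
  by (cases a; cases b; simp add: sigma_plus_def sigma_minus_def mat_of_rows_list_def scalar_prod_def numeral_2_eq_2)+

lemma sigma_basis_carrier: "M \<in> sigma_basis \<Longrightarrow> M \<in> carrier_mat 2 2"
  by (auto simp: sigma_basis_def sigma_plus_def sigma_minus_def mat_of_rows_list_def)

text \<open>
  A factor annihilates one of the two basis states exactly when the Toffoli gate of the circuit
  gets a control on its qubit: closed if the input \<open>0\<close> is annihilated, open if \<open>1\<close> is.
\<close>

definition closed_factor :: "complex mat \<Rightarrow> bool" where
  "closed_factor M \<longleftrightarrow> M $$ (0, 0) = 0 \<and> M $$ (1, 0) = 0"

definition open_factor :: "complex mat \<Rightarrow> bool" where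
  "open_factor M \<longleftrightarrow> M $$ (0, 1) = 0 \<and> M $$ (1, 1) = 0"

text \<open>Column 0 vanishes for \<open>sigma_plus\<close> and
  \<open>sigma_minus * sigma_plus\<close>, column 1 for \<open>sigma_minus\<close> and
  \<open>sigma_plus * sigma_minus\<close>, and neither for the identity. A nonzero column holds a
  single one, off the diagonal exactly for \<open>sigma_plus\<close> and
  \<open>sigma_minus\<close>.\<close>

lemma sigma_basis_entry:
  assumes "M \<in> sigma_basis"
  shows "M $$ (of_bool a, of_bool b) = of_bool ((closed_factor M \<longrightarrow> b) \<and> (open_factor M \<longrightarrow> \<not> b) \<and>
     (a \<longleftrightarrow> (b \<noteq> (M \<in> {sigma_plus, sigma_minus}))))"
proof -
  note e = sigma_entry[of True True, unfolded of_bool_eq] sigma_entry[of True False, unfolded of_bool_eq]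
    sigma_entry[of False True, unfolded of_bool_eq] sigma_entry[of False False, unfolded of_bool_eq]
  have neI: "P \<noteq> Q" if "P $$ x \<noteq> Q $$ x" for P Q :: "complex mat" and x
    using that by auto
  \<comment> \<open>Evaluating membership in \<open>{sigma_plus, sigma_minus}\<close> requires these
    matrices to differ; each pair is separated by one of its off-diagonal entries.\<close>
  have ne: "sigma_plus \<noteq> sigma_minus"
    "1\<^sub>m 2 \<noteq> sigma_plus" "1\<^sub>m 2 \<noteq> sigma_minus"
    "sigma_plus * sigma_minus \<noteq> sigma_plus" "sigma_plus * sigma_minus \<noteq> sigma_minus"
    "sigma_minus * sigma_plus \<noteq> sigma_plus" "sigma_minus * sigma_plus \<noteq> sigma_minus"
    by (rule neI[of _ "(0, 1)"] neI[of _ "(1, 0)"],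
      simp only: e simp_thms of_bool_eq zero_neq_one one_neq_zero not_True_eq_False not_False_eq_True)+
  consider "M = 1\<^sub>m 2" | "M = sigma_plus" | "M = sigma_minus" | "M = sigma_plus * sigma_minus"
    | "M = sigma_minus * sigma_plus"
    using assms by (auto simp: sigma_basis_def)
  then show "M $$ (of_bool a, of_bool b) = of_bool ((closed_factor M \<longrightarrow> b) \<and> (open_factor M \<longrightarrow> \<not> b) \<and>
     (a \<longleftrightarrow> (b \<noteq> (M \<in> {sigma_plus, sigma_minus}))))"
    by cases (cases a; cases b;
      simp add: e ne ne[symmetric] closed_factor_def open_factor_def del: index_mult_mat One_nat_def index_one_mat)+
qed

text \<open>No Sigma matrix is zero. This makes the closed and open control sets of the
  multi-controlled gate disjoint, as its validity demands.\<close>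

lemma sigma_basis_not_closed_and_open:
  assumes "M \<in> sigma_basis"
  shows "\<not> (closed_factor M \<and> open_factor M)"
proof -
  note e = sigma_entry[of True True, unfolded of_bool_eq] sigma_entry[of True False, unfolded of_bool_eq]
    sigma_entry[of False True, unfolded of_bool_eq] sigma_entry[of False False, unfolded of_bool_eq]
  from assms show ?thesis
    unfolding sigma_basis_def closed_factor_def open_factor_def
    by (elim insertE emptyE) (simp_all add: e del: index_mult_mat One_nat_def index_one_mat)
qed

text \<open>As \<open>f\<close> is an involution, the transpose of \<open>A\<close> is again
  \<open>f\<close>, now restricted to the image of \<open>D\<close>, which is the set of
  \<open>x\<close> with \<open>D (f x)\<close>. The two products of \<open>A\<close> with its
  transpose are the diagonal projections onto \<open>D\<close> and onto that image. So every column
  of the block matrix has a single one: in the diagonal block if the partial map is defined there,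
  otherwise in the complementary projection.\<close>

lemma dilation_op_partial_involution:
  assumes A: "A = mat (2 ^ n) (2 ^ n) (\<lambda>(i, j). of_bool (D j \<and> i = f j))"
    and f: "\<And>j. j < 2 ^ n \<Longrightarrow> f j < 2 ^ n" "\<And>j. f (f j) = j"
    and F: "\<And>x. x < 2 ^ n \<Longrightarrow> F x = (if D x then f x else 2 ^ n + x)"
           "\<And>x. x < 2 ^ n \<Longrightarrow> F (2 ^ n + x) = (if D (f x) then 2 ^ n + f x else x)"
  shows "dilation_op n A = perm_mat (n + 1) F"
proof -
  have AtA: "(A\<^sup>T * A) $$ (i, j) = of_bool (i = j \<and> D j)" if "i < 2 ^ n" "j < 2 ^ n" for i j
  proof -
    have "(A\<^sup>T * A) $$ (i, j) = (\<Sum>k = 0..<2 ^ n. of_bool (D i \<and> k = f i) * of_bool (D j \<and> k = f j))"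
      using that by (simp add: A scalar_prod_def)
    also have "\<dots> = (\<Sum>k = 0..<2 ^ n. if k = f j then of_bool (D i \<and> k = f i \<and> D j) else 0)"
      by (intro sum.cong) auto
    also have "\<dots> = of_bool (D i \<and> f j = f i \<and> D j)"
      using f(1)[OF that(2)] by (simp add: sum.delta)
    also have "D i \<and> f j = f i \<and> D j \<longleftrightarrow> i = j \<and> D j" using f(2) by metis
    finally show ?thesis .
  qed
  have AAt: "(A * A\<^sup>T) $$ (i, j) = of_bool (i = j \<and> D (f j))" if "i < 2 ^ n" "j < 2 ^ n" for i j
  proof -
    have "(A * A\<^sup>T) $$ (i, j) = (\<Sum>k = 0..<2 ^ n. of_bool (D k \<and> i = f k) * of_bool (D k \<and> j = f k))"
      using that by (simp add: A scalar_prod_def)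
    \<comment> \<open>Applying \<open>f\<close> to \<open>j = f k\<close> gives
      \<open>k = f j\<close>, and then \<open>i = f k\<close> becomes \<open>i = j\<close>.\<close>
    also have "\<dots> = (\<Sum>k = 0..<2 ^ n. if k = f j then of_bool (D k \<and> i = j) else 0)"
    proof (intro sum.cong refl)
      fix k
      show "of_bool (D k \<and> i = f k) * of_bool (D k \<and> j = f k) =
          (if k = f j then of_bool (D k \<and> i = j) else 0 :: complex)"
        using f(2)[of j] f(2)[of k] by (cases "k = f j") auto
    qed
    also have "\<dots> = of_bool (i = j \<and> D (f j))"
      using f(1)[OF that(2)] by (simp add: sum.delta conj_commute)
    finally show ?thesis .
  qed
  have dims: "dim_row A = 2 ^ n" "dim_col A = 2 ^ n" by (simp_all add: A)
  have blocks: "(1\<^sub>m (2 ^ n) - A\<^sup>T * A) $$ (i, j) = of_bool (i = j \<and> \<not> D j)"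
    "(1\<^sub>m (2 ^ n) - A * A\<^sup>T) $$ (i, j) = of_bool (i = j \<and> \<not> D (f j))"
    "A $$ (i, j) = of_bool (D j \<and> i = f j)" "A\<^sup>T $$ (i, j) = of_bool (D (f j) \<and> i = f j)"
    if "i < 2 ^ n" "j < 2 ^ n" for i j
  proof -
    show "(1\<^sub>m (2 ^ n) - A\<^sup>T * A) $$ (i, j) = of_bool (i = j \<and> \<not> D j)"
      using that by (subst index_minus_mat(1)) (auto simp: dims AtA simp del: index_mult_mat(1))
    show "(1\<^sub>m (2 ^ n) - A * A\<^sup>T) $$ (i, j) = of_bool (i = j \<and> \<not> D (f j))"
      using that by (subst index_minus_mat(1)) (auto simp: dims AAt simp del: index_mult_mat(1))
    show "A $$ (i, j) = of_bool (D j \<and> i = f j)"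
      using that by (simp add: A)
    \<comment> \<open>Rewriting the transposed entry through \<open>f (f i) = i\<close> makes both
      the domain condition and the target depend on the column index.\<close>
    have "D i \<and> j = f i \<longleftrightarrow> D (f j) \<and> i = f j" using f(2) by metis
    then show "A\<^sup>T $$ (i, j) = of_bool (D (f j) \<and> i = f j)"
      using that by (simp add: A)
  qed
  show ?thesis
  proof (intro eq_matI)
    fix i j assume "i < dim_row (perm_mat (n + 1) F)" "j < dim_col (perm_mat (n + 1) F)"
    then have ij: "i < 2 ^ n + 2 ^ n" "j < 2 ^ n + 2 ^ n" by (auto simp: perm_mat_def)
    have four: "dilation_op n A $$ (i, j) =
       (if i < 2 ^ n then if j < 2 ^ n then A $$ (i, j) else (1\<^sub>m (2 ^ n) - A * A\<^sup>T) $$ (i, j - 2 ^ n)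
        else if j < 2 ^ n then (1\<^sub>m (2 ^ n) - A\<^sup>T * A) $$ (i - 2 ^ n, j)
        else A\<^sup>T $$ (i - 2 ^ n, j - 2 ^ n))"
      using ij unfolding dilation_op_def by (subst index_mat_four_block(1)) (simp_all add: dims)
    have perm: "perm_mat (n + 1) F $$ (i, j) = of_bool (i = F j)"
      using ij by (simp add: perm_mat_def)
    show "dilation_op n A $$ (i, j) = perm_mat (n + 1) F $$ (i, j)"
    proof (cases "j < 2 ^ n")
      case True
      show ?thesis
      proof (cases "i < 2 ^ n")
        case i: True
        with True show ?thesis unfolding four perm by (simp add: blocks F(1))
      next
        case i: False
        then have "i - 2 ^ n < 2 ^ n" using ij by simp
        with True i f(1)[OF True] show ?thesis unfolding four perm by (auto simp: blocks F(1))
      qed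
    next
      case False
      define x where "x = j - 2 ^ n"
      have x: "x < 2 ^ n" "j = 2 ^ n + x" using False ij by (auto simp: x_def)
      show ?thesis
      proof (cases "i < 2 ^ n")
        case i: True
        with x show ?thesis unfolding four perm by (simp add: blocks F(2))
      next
        case i: False
        then have "i - 2 ^ n < 2 ^ n" using ij by simp
        with x i f(1)[OF x(1)] show ?thesis unfolding four perm by (auto simp: blocks F(2))
      qed
    qed
  qed (auto simp: dilation_op_def perm_mat_def dims)
qed

section \<open>Construction and verification of the circuit\<close>

theorem theorem4:
  fixes n s :: nat and \<sigma> :: "nat \<Rightarrow> complex mat" and A :: "complex mat"
  assumes "n \<ge> 1"
    and "\<forall>i<n. \<sigma> i \<in> sigma_basis"
    and "A = tensor_list (map \<sigma> [0..<n])"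
    and "s = card {i. i < n \<and> \<sigma> i \<in> {sigma_plus, sigma_minus}}"
  shows "\<exists>gs. (\<forall>g\<in>set gs. valid_gate (n + 1) g) \<and>
              length (filter is_single gs) = 1 \<and>
              length (filter (\<lambda>g. \<exists>m\<le>n. is_CmX m g) gs) = 2 * s + 1 \<and>
              length gs = 1 + (2 * s + 1) \<and>
              circuit_mat (n + 1) gs = dilation_op n A"
proof -
  \<comment> \<open>\<open>D\<close> reads only bits below \<open>n\<close>, so it applies unchanged
    to indices of the whole register, whatever the ancilla holds.\<close>
  define D where "D j \<longleftrightarrow> (\<forall>k<n. (closed_factor (\<sigma> k) \<longrightarrow> bit j (n - 1 - k)) \<and>
      (open_factor (\<sigma> k) \<longrightarrow> \<not> bit j (n - 1 - k)))" for j :: nat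
  define ks where "ks = filter (\<lambda>k. \<sigma> k \<in> {sigma_plus, sigma_minus}) [0..<n]"
  define f where "f j = j XOR flip_mask n ks" for j
  define cn where "cn = map (\<lambda>k. CX {0} {} (k + 1)) ks"
  \<comment> \<open>\<open>Suc\<close> skips the ancilla, which is qubit 0.\<close>
  define C where "C = Suc ` {k. k < n \<and> closed_factor (\<sigma> k)}"
  define P where "P = Suc ` {k. k < n \<and> open_factor (\<sigma> k)}"
  \<comment> \<open>The list is a matrix product, so its last gate acts first and the single-qubit X
    on the ancilla acts last.\<close>
  define gs where "gs = Single 0 X_gate # cn @ CX C P 0 # cn"
  define cnot where "cnot j = (if bit j n then f j else j)" for j
  define toff where "toff j = (if D j then j XOR 2 ^ n else j)" for j

  have ks: "distinct ks" "set ks \<subseteq> {..<n}" by (auto simp: ks_def)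
  have length_ks: "length ks = s"
    unfolding assms(4) distinct_card[OF ks(1), symmetric]
    by (rule arg_cong[where f = card]) (auto simp: ks_def)
  have mask: "flip_mask n ks < 2 ^ n" "\<And>k. k < n \<Longrightarrow> bit (flip_mask n ks) (n - 1 - k) \<longleftrightarrow> k \<in> set ks"
    using ks flip_mask_less bit_flip_mask by auto
  then have mask_n: "\<not> bit (flip_mask n ks) n" using bit_index_less by blast
  have f: "f j < 2 ^ n" if "j < 2 ^ n" for j
    using that mask(1) by (auto simp: f_def xor_nat_less_power2)
  have ff: "f (f j) = j" for j by (simp add: f_def xor.assoc)

  have A: "A = mat (2 ^ n) (2 ^ n) (\<lambda>(i, j). of_bool (D j \<and> i = f j))"
  proof -
    have basis: "\<sigma> k \<in> sigma_basis" if "k < n" for k using assms(2) that by blast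
    then have "M \<in> carrier_mat 2 2" if "M \<in> set (map \<sigma> [0..<n])" for M
      using that by (auto intro!: sigma_basis_carrier)
    note T = tensor_list_entry[of "map \<sigma> [0..<n]", OF this, unfolded length_map length_upt diff_zero, folded assms(3)]
    have "A $$ (i, j) = of_bool (D j \<and> i = f j)" if ij: "i < 2 ^ n" "j < 2 ^ n" for i j
    proof -
      have "A $$ (i, j) = (\<Prod>k<n. \<sigma> k $$ (of_bool (bit i (n - 1 - k)), of_bool (bit j (n - 1 - k))))"
        using T ij by simp
      also have "\<dots> = (\<Prod>k<n. of_bool ((closed_factor (\<sigma> k) \<longrightarrow> bit j (n - 1 - k)) \<and>
          (open_factor (\<sigma> k) \<longrightarrow> \<not> bit j (n - 1 - k)) \<and>
          (bit i (n - 1 - k) \<longleftrightarrow> bit (f j) (n - 1 - k))))"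
      proof (intro prod.cong refl)
        fix k assume "k \<in> {..<n}"
        then have k: "k < n" by simp
        have "k \<in> set ks \<longleftrightarrow> \<sigma> k \<in> {sigma_plus, sigma_minus}" using k by (auto simp: ks_def)
        then show "\<sigma> k $$ (of_bool (bit i (n - 1 - k)), of_bool (bit j (n - 1 - k))) =
            of_bool ((closed_factor (\<sigma> k) \<longrightarrow> bit j (n - 1 - k)) \<and>
          (open_factor (\<sigma> k) \<longrightarrow> \<not> bit j (n - 1 - k)) \<and>
          (bit i (n - 1 - k) \<longleftrightarrow> bit (f j) (n - 1 - k)))"
          unfolding sigma_basis_entry[OF basis[OF k]] f_def bit_xor_iff mask(2)[OF k] by simp
      qed
      also have "\<dots> = of_bool (\<forall>k<n. (closed_factor (\<sigma> k) \<longrightarrow> bit j (n - 1 - k)) \<and>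
          (open_factor (\<sigma> k) \<longrightarrow> \<not> bit j (n - 1 - k)) \<and>
          (bit i (n - 1 - k) \<longleftrightarrow> bit (f j) (n - 1 - k)))"
        by (rule prod_of_bool_lessThan)
      also have "(\<forall>k<n. (closed_factor (\<sigma> k) \<longrightarrow> bit j (n - 1 - k)) \<and>
          (open_factor (\<sigma> k) \<longrightarrow> \<not> bit j (n - 1 - k)) \<and>
          (bit i (n - 1 - k) \<longleftrightarrow> bit (f j) (n - 1 - k))) \<longleftrightarrow>
          D j \<and> (\<forall>k<n. bit i (n - 1 - k) \<longleftrightarrow> bit (f j) (n - 1 - k))"
        unfolding D_def by blast
      also have "(\<forall>k<n. bit i (n - 1 - k) \<longleftrightarrow> bit (f j) (n - 1 - k)) \<longleftrightarrow> i = f j"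
        unfolding eq_iff_bits_below[OF ij(1) f[OF ij(2)]]
        by (rule all_less_reverse_iff)
      finally show ?thesis .
    qed
    then show ?thesis using T by (intro eq_matI) auto
  qed

  have valid: "\<forall>g\<in>set gs. valid_gate (n + 1) g"
    using ks(2) assms(2) sigma_basis_not_closed_and_open
    by (auto simp: gs_def cn_def C_def P_def unitary_mat2_X_gate)
  have "C \<union> P \<subseteq> {1..n}" by (auto simp: C_def P_def)
  then have "card (C \<union> P) \<le> n"
    using card_mono[of "{1..n}" "C \<union> P"] by simp
  \<comment> \<open>The middle gate has at most \<open>n\<close> controls; each CNOT has exactly
    one, which is admissible because \<open>n\<close> is at least 1.\<close>
  then have "length (filter (\<lambda>g. \<exists>m\<le>n. is_CmX m g) gs) = 2 * s + 1"
    using assms(1) by (simp add: gs_def cn_def filter_map o_def length_ks)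
  moreover have "length (filter is_single gs) = 1"
    by (simp add: gs_def cn_def filter_map o_def)
  moreover have "length gs = 1 + (2 * s + 1)"
    by (simp add: gs_def cn_def length_ks)
  moreover have "circuit_mat (n + 1) gs = dilation_op n A"
  proof -
    have cn: "circuit_mat (n + 1) cn = perm_mat (n + 1) cnot"
      unfolding cn_def circuit_mat_ancilla_cnots[OF ks(2)] by (simp add: cnot_def[abs_def] f_def cong: if_cong)
    \<comment> \<open>Among \<open>n + 1\<close> qubits, qubit \<open>Suc k\<close> sits at bit
      \<open>n - 1 - k\<close>, the bit that \<open>D\<close> tests for factor \<open>k\<close>, and
      the target, qubit 0, sits at bit \<open>n\<close>.\<close>
    have toff: "gate_mat (n + 1) (CX C P 0) = perm_mat (n + 1) toff"
      by (subst gate_mat_CX) (auto simp: toff_def D_def C_def P_def intro!: perm_mat_cong)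
    have X: "gate_mat (n + 1) (Single 0 X_gate) = perm_mat (n + 1) (\<lambda>j. j XOR 2 ^ n)"
      by (simp add: on_qubit_X)
    have "f j < 2 ^ (n + 1)" if "j < 2 ^ (n + 1)" for j
      using that mask(1) unfolding f_def by (intro xor_nat_less_power2) auto
    moreover have "j XOR 2 ^ n < 2 ^ (n + 1)" if "j < 2 ^ (n + 1)" for j :: nat
      using that by (intro xor_nat_less_power2) auto
    ultimately have bounds: "cnot j < 2 ^ (n + 1)" "toff j < 2 ^ (n + 1)" if "j < 2 ^ (n + 1)" for j
      using that by (simp_all add: cnot_def toff_def)
    have append: "circuit_mat (n + 1) (cn @ CX C P 0 # cn) =
        circuit_mat (n + 1) cn * circuit_mat (n + 1) (CX C P 0 # cn)"
      using valid by (intro circuit_mat_append) (auto simp only: gs_def set_simps set_append)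
    have "circuit_mat (n + 1) gs = perm_mat (n + 1) (\<lambda>j. j XOR 2 ^ n) *
        (perm_mat (n + 1) cnot * (perm_mat (n + 1) toff * perm_mat (n + 1) cnot))"
      by (simp only: gs_def append circuit_mat_Cons cn X toff)
    also have "\<dots> = perm_mat (n + 1) (\<lambda>j. cnot (toff (cnot j)) XOR 2 ^ n)"
      by (simp only: perm_mat_mult bounds)
    also have "\<dots> = dilation_op n A"
    proof (rule dilation_op_partial_involution[OF A, symmetric])
      have D_xor: "D (j XOR 2 ^ n) = D j" for j
        by (auto simp: D_def bit_xor_iff bit_exp_iff)
      have f_xor: "f (j XOR 2 ^ n) = f j XOR 2 ^ n" for j
        by (simp add: f_def ac_simps)
      fix x :: nat assume x: "x < 2 ^ n"
      have bits: "\<not> bit x n" "\<not> bit (f x) n"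
        using x f[OF x] bit_index_less by blast+
      have bx: "bit (j XOR 2 ^ n) n \<longleftrightarrow> \<not> bit j n" for j :: nat
        by (simp add: bit_xor_iff bit_exp_iff)
      have xx: "(j XOR 2 ^ n) XOR 2 ^ n = j" for j :: nat by (simp add: xor.assoc)
      \<comment> \<open>With ancilla 0 the first CNOT layer is idle. If \<open>D x\<close>, the
        ancilla is set, the second layer applies \<open>f\<close>, and the final X clears the
        ancilla; otherwise only the final X has an effect.\<close>
      show "cnot (toff (cnot x)) XOR 2 ^ n = (if D x then f x else 2 ^ n + x)"
        using bits by (simp add: cnot_def toff_def bx f_xor xx add_power2_eq_xor x)
      \<comment> \<open>With ancilla 1 the first layer produces \<open>f x\<close>. If
        \<open>D (f x)\<close>, the ancilla is cleared, the second layer is idle, and X sets the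
        ancilla again; otherwise the second layer undoes the first and X clears the ancilla.\<close>
      show "cnot (toff (cnot (2 ^ n + x))) XOR 2 ^ n = (if D (f x) then 2 ^ n + f x else x)"
        using bits by (simp add: cnot_def toff_def bx f_xor D_xor xx ff add_power2_eq_xor x f)
    qed (use f ff in auto)
    finally show ?thesis .
  qed
  ultimately show ?thesis using valid by blast
qed

end
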